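(* Let $S=\mathbb{C}[z_1,z_2,\dots]$ be the polynomial ring over $\mathbb{C}$ in countably infinitely many variables indexed by $\mathbb{N}=\{1,2,\dots\}$, and let $\mathfrak{J}$ be an ideal of $S$. Then $I(V(\mathfrak{J}))=\sqrt{\mathfrak{J}}$.
   Context: For an ideal $\mathfrak{J}$ of $S$, $V(\mathfrak{J})=\{a\in\mathbb{C}^{\mathbb{N}}: f(a)=0\text{ for all }f\in\mathfrak{J}\}$. For $X\subseteq\mathbb{C}^{\mathbb{N}}$, $I(X)=\{f\in S: f(a)=0\text{ for all }a\in X\}$. *)

theory Defs
  imports Complex_Main "HOL-Library.Poly_Mapping"
begin

text \<open>
  The ring \<open>\<complex>[z\<^sub>1, z\<^sub>2, \<dots>]\<close>: a monomial is a finitely supported map from variable indices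
  to exponents, a polynomial is a finitely supported map from monomials to coefficients, and the
  ring operations are those of \<^theory>\<open>HOL-Library.Poly_Mapping\<close> (convolution product).
  The countably many variables are indexed by \<^typ>\<open>nat\<close>, the index \<open>i\<close> standing for \<open>z\<^bsub>i+1\<^esub>\<close>;
  in the same way a point of \<open>\<complex>\<^sup>\<nat>\<close> is a function on \<^typ>\<open>nat\<close>.
\<close>

type_synonym monomial = "nat \<Rightarrow>\<^sub>0 nat"
type_synonym inf_poly = "monomial \<Rightarrow>\<^sub>0 complex"
type_synonym point = "nat \<Rightarrow> complex"

definition eval_monomial :: "point \<Rightarrow> monomial \<Rightarrow> complex" where
  "eval_monomial a m = (\<Prod>i\<in>Poly_Mapping.keys m. a i ^ Poly_Mapping.lookup m i)"

definition eval_poly :: "point \<Rightarrow> inf_poly \<Rightarrow> complex" where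
  "eval_poly a f = (\<Sum>m\<in>Poly_Mapping.keys f. Poly_Mapping.lookup f m * eval_monomial a m)"

text \<open>An ideal of a commutative ring is a submodule of the ring regarded as a module over itself.\<close>

definition is_ideal :: "'a::comm_ring_1 set \<Rightarrow> bool" where
  "is_ideal J \<longleftrightarrow> module.subspace (*) J"

lemma is_ideal_iff:
  "is_ideal J \<longleftrightarrow> 0 \<in> J \<and> (\<forall>x\<in>J. \<forall>y\<in>J. x + y \<in> J) \<and> (\<forall>c. \<forall>x\<in>J. c * x \<in> J)"
proof -
  interpret module "(*) :: 'a \<Rightarrow> 'a \<Rightarrow> 'a"
    by unfold_locales (simp_all add: algebra_simps)
  show ?thesis
    by (simp add: is_ideal_def subspace_def)
qed

definition radical :: "'a::comm_ring_1 set \<Rightarrow> 'a set" where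
  "radical J = {f. \<exists>n::nat. n \<ge> 1 \<and> f ^ n \<in> J}"

definition zero_locus :: "inf_poly set \<Rightarrow> point set" where
  "zero_locus J = {a. \<forall>f\<in>J. eval_poly a f = 0}"

definition vanishing_ideal :: "point set \<Rightarrow> inf_poly set" where
  "vanishing_ideal X = {f. \<forall>a\<in>X. eval_poly a f = 0}"

end

theory Submission
  imports Defs "HOL-Analysis.Continuum_Not_Denumerable"
    "HOL-Computational_Algebra.Fundamental_Theorem_Algebra"
begin

text \<open>
  Suppose that no power of \<open>f\<close> lies in \<open>J\<close>, and let \<open>P \<supseteq> J\<close> be maximal among the ideals containing
  no power of \<open>f\<close>; it is prime. Every polynomial \<open>g\<close> is congruent to a constant modulo \<open>P\<close>:
  otherwise, for each of the uncountably many \<open>c \<in> \<complex>\<close>, maximality gives \<open>h\<^sub>c (g - c) \<equiv> f\<^sup>n\<close> modulo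
  \<open>P\<close>. As the ring has countable dimension over \<open>\<complex>\<close>, some \<open>h\<^sub>c\<close> sharing the same \<open>n\<close> satisfy a
  nontrivial relation \<open>\<Sum> a\<^sub>c h\<^sub>c = 0\<close>, and multiplying it by \<open>\<Prod> (g - c)\<close> gives \<open>f\<^sup>n q(g) \<in> P\<close> with
  \<open>q \<noteq> 0\<close> a complex polynomial in one variable. Since \<open>q\<close> splits into linear factors and \<open>P\<close> is
  prime, some \<open>g - r\<close> lies in \<open>P\<close> after all. Applied to the variables, this yields a point \<open>a\<close> such
  that \<open>g \<equiv> g(a)\<close> modulo \<open>P\<close> for all \<open>g\<close>. Hence \<open>a\<close> is a zero of \<open>P \<supseteq> J\<close> but not of \<open>f\<close>.
\<close>

section \<open>Ideals avoiding the powers of an element\<close>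

lemma is_ideal_zero: "is_ideal I \<Longrightarrow> 0 \<in> I"
  and is_ideal_add: "is_ideal I \<Longrightarrow> x \<in> I \<Longrightarrow> y \<in> I \<Longrightarrow> x + y \<in> I"
  and is_ideal_mult_left: "is_ideal I \<Longrightarrow> x \<in> I \<Longrightarrow> c * x \<in> I"
  by (auto simp: is_ideal_iff)

lemma is_ideal_diff:
  assumes "is_ideal I" "x \<in> I" "y \<in> I"
  shows "x - y \<in> I"
  using is_ideal_add[OF assms(1,2) is_ideal_mult_left[OF assms(1,3), of "-1"]] by simp

lemma is_ideal_sum:
  assumes "is_ideal I" "\<And>x. x \<in> A \<Longrightarrow> f x \<in> I"
  shows "sum f A \<in> I"
  using assms(2)
  by (induction A rule: infinite_finite_induct)
     (auto intro: is_ideal_zero is_ideal_add assms(1))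

lemma is_ideal_add_principal:
  assumes "is_ideal I"
  shows "is_ideal {p + b * x |p b. p \<in> I}"
  unfolding is_ideal_iff
proof (intro conjI ballI allI)
  show "0 \<in> {p + b * x |p b. p \<in> I}"
    using is_ideal_zero[OF assms] by (intro CollectI exI[of _ 0]) simp
next
  fix u v assume "u \<in> {p + b * x |p b. p \<in> I}" "v \<in> {p + b * x |p b. p \<in> I}"
  then obtain p b p' b' where "u = p + b * x" "v = p' + b' * x" "p \<in> I" "p' \<in> I"
    by blast
  then have "u + v = (p + p') + (b + b') * x" "p + p' \<in> I"
    by (auto simp: algebra_simps intro: is_ideal_add assms)
  then show "u + v \<in> {p + b * x |p b. p \<in> I}"
    by blast
next
  fix c u assume "u \<in> {p + b * x |p b. p \<in> I}"
  then obtain p b where "u = p + b * x" "p \<in> I"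
    by blast
  then have "c * u = c * p + (c * b) * x" "c * p \<in> I"
    by (auto simp: algebra_simps intro: is_ideal_mult_left assms)
  then show "c * u \<in> {p + b * x |p b. p \<in> I}"
    by blast
qed

lemma is_ideal_Union_chain:
  assumes "\<C> \<noteq> {}" "\<And>I. I \<in> \<C> \<Longrightarrow> is_ideal I" "\<And>I K. I \<in> \<C> \<Longrightarrow> K \<in> \<C> \<Longrightarrow> I \<subseteq> K \<or> K \<subseteq> I"
  shows "is_ideal (\<Union>\<C>)"
  unfolding is_ideal_iff
proof (intro conjI ballI allI)
  show "0 \<in> \<Union>\<C>"
    using assms(1,2) is_ideal_zero by blast
next
  fix x y assume "x \<in> \<Union>\<C>" "y \<in> \<Union>\<C>"
  then obtain I K where "I \<in> \<C>" "x \<in> I" "K \<in> \<C>" "y \<in> K"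
    by blast
  then obtain M where "M \<in> \<C>" "x \<in> M" "y \<in> M"
    using assms(3)[of I K] by blast
  then show "x + y \<in> \<Union>\<C>"
    using is_ideal_add[OF assms(2)] by blast
next
  fix c x assume "x \<in> \<Union>\<C>"
  then show "c * x \<in> \<Union>\<C>"
    using assms(2) is_ideal_mult_left by blast
qed

text \<open>The exponent \<open>n = 0\<close> is included, so such an ideal is proper. These are the
  contractions of the maximal ideals of the localization at \<open>f\<close>.\<close>

definition max_avoiding :: "'a::comm_ring_1 \<Rightarrow> 'a set \<Rightarrow> bool" where
  "max_avoiding f P \<longleftrightarrow> is_ideal P \<and> (\<forall>n. f ^ n \<notin> P) \<and>
     (\<forall>I. is_ideal I \<longrightarrow> P \<subseteq> I \<longrightarrow> (\<forall>n. f ^ n \<notin> I) \<longrightarrow> I = P)"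

text \<open>Zorn's lemma applies because a power of \<open>f\<close> in the union of a chain would
  already lie in one of its members.\<close>

lemma max_avoiding_exists:
  assumes "is_ideal J" "\<And>n. f ^ n \<notin> J"
  obtains P where "J \<subseteq> P" "max_avoiding f P"
proof -
  define \<A> where "\<A> = {I. is_ideal I \<and> J \<subseteq> I \<and> (\<forall>n. f ^ n \<notin> I)}"
  have "\<exists>M\<in>\<A>. \<forall>X\<in>\<A>. M \<subseteq> X \<longrightarrow> X = M"
  proof (rule subset_Zorn_nonempty)
    show "\<A> \<noteq> {}"
      using assms by (auto simp: \<A>_def)
  next
    fix \<C> assume "\<C> \<noteq> {}" "subset.chain \<A> \<C>"
    then have sub: "\<C> \<subseteq> \<A>" and chain: "\<And>I K. I \<in> \<C> \<Longrightarrow> K \<in> \<C> \<Longrightarrow> I \<subseteq> K \<or> K \<subseteq> I"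
      by (auto simp: subset_chain_def)
    have "is_ideal (\<Union>\<C>)"
      using \<open>\<C> \<noteq> {}\<close> sub chain by (intro is_ideal_Union_chain) (auto simp: \<A>_def)
    then show "\<Union>\<C> \<in> \<A>"
      using \<open>\<C> \<noteq> {}\<close> sub by (fastforce simp: \<A>_def)
  qed
  then obtain M where "M \<in> \<A>" and max: "\<And>X. X \<in> \<A> \<Longrightarrow> M \<subseteq> X \<Longrightarrow> X = M"
    by blast
  \<comment> \<open>Every ideal above \<open>M\<close> also contains \<open>J\<close>, so maximality
    within \<open>\<A>\<close> is maximality among all ideals avoiding the powers.\<close>
  then have "J \<subseteq> M" "max_avoiding f M"
    unfolding max_avoiding_def \<A>_def by auto
  then show thesis ..
qed

lemma max_avoiding_ideal: "max_avoiding f P \<Longrightarrow> is_ideal P"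
  and max_avoiding_power: "max_avoiding f P \<Longrightarrow> f ^ n \<notin> P"
  by (auto simp: max_avoiding_def)

lemma max_avoiding_one: "max_avoiding f P \<Longrightarrow> 1 \<notin> P"
  using max_avoiding_power[of f P 0] by simp

text \<open>The ideal generated by \<open>P\<close> and \<open>x\<close> is strictly larger than
  \<open>P\<close>, so it contains a power of \<open>f\<close>: modulo \<open>P\<close>,
  \<open>x\<close> becomes invertible once \<open>f\<close> is inverted.\<close>

lemma max_avoiding_absorb:
  assumes "max_avoiding f P" "x \<notin> P"
  obtains n b where "f ^ n - b * x \<in> P"
proof -
  define I where "I = {p + b * x |p b. p \<in> P}"
  have P: "is_ideal P"
    using assms(1) by (rule max_avoiding_ideal)
  have "is_ideal I"
    unfolding I_def using P by (rule is_ideal_add_principal)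
  moreover have "P \<subseteq> I"
  proof
    fix p assume "p \<in> P"
    then show "p \<in> I"
      unfolding I_def by (intro CollectI exI[of _ p] exI[of _ 0]) simp
  qed
  moreover have "x \<in> I"
    unfolding I_def using is_ideal_zero[OF P]
    by (intro CollectI exI[of _ 0] exI[of _ 1]) simp
  ultimately obtain n where "f ^ n \<in> I"
    using assms unfolding max_avoiding_def by metis
  then obtain p b where "f ^ n = p + b * x" "p \<in> P"
    by (auto simp: I_def)
  then have "f ^ n - b * x \<in> P"
    by simp
  then show thesis ..
qed

lemma max_avoiding_prime:
  assumes "max_avoiding f P" "x * y \<in> P"
  shows "x \<in> P \<or> y \<in> P"
proof (rule ccontr)
  assume "\<not> (x \<in> P \<or> y \<in> P)"
  then obtain m b n c where *: "f ^ m - b * x \<in> P" "f ^ n - c * y \<in> P"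
    using max_avoiding_absorb[OF assms(1)] by metis
  note P = max_avoiding_ideal[OF assms(1)]
  \<comment> \<open>Multiplying \<open>f ^ m \<equiv> b * x\<close> by
    \<open>f ^ n \<equiv> c * y\<close> gives
    \<open>f ^ (m + n) \<equiv> (b * c) * (x * y) \<equiv> 0\<close> modulo
    \<open>P\<close>.\<close>
  have "f ^ n * (f ^ m - b * x) + b * x * (f ^ n - c * y) + (b * c) * (x * y) \<in> P"
    by (intro is_ideal_add is_ideal_mult_left P * assms(2))
  also have "f ^ n * (f ^ m - b * x) + b * x * (f ^ n - c * y) + (b * c) * (x * y) = f ^ (m + n)"
    by (simp add: algebra_simps power_add)
  finally show False
    using max_avoiding_power[OF assms(1)] by blast
qed

section \<open>Linear dependence\<close>

text \<open>Gaussian elimination, one equation \<open>m \<in> F\<close> at a time; the unknowns are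
  the \<open>a c\<close> with \<open>c \<in> D\<close>.\<close>

lemma homogeneous_system_nontrivial:
  fixes h :: "'i \<Rightarrow> 'k \<Rightarrow> 'a::field"
  assumes "finite F" "finite D" "card F < card D"
  shows "\<exists>a. (\<exists>c\<in>D. a c \<noteq> 0) \<and> (\<forall>m\<in>F. (\<Sum>c\<in>D. a c * h c m) = 0)"
  using assms
proof (induction F arbitrary: D h rule: finite_induct)
  case empty
  then have "D \<noteq> {}" by auto
  then show ?case by (auto intro!: exI[of _ "\<lambda>_. 1"])
next
  case (insert m F)
  show ?case
  proof (cases "\<forall>c\<in>D. h c m = 0")
    case True
    have "card F < card D"
      using insert by simp
    then obtain a where "\<exists>c\<in>D. a c \<noteq> 0" "\<forall>k\<in>F. (\<Sum>c\<in>D. a c * h c k) = 0"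
      using insert.IH[OF insert.prems(1)] by blast
    moreover have "(\<Sum>c\<in>D. a c * h c m) = 0"
      using True by simp
    ultimately show ?thesis by blast
  next
    case False
    then obtain d where d: "d \<in> D" "h d m \<noteq> 0" by blast
    let ?D = "D - {d}"
    \<comment> \<open>Equation \<open>m\<close> is solved for the unknown at the pivot
      \<open>d\<close>; substituting the solution into the other equations gives the coefficients
      \<open>h'\<close>. Since \<open>h' c m = 0\<close>, equation \<open>m\<close> then holds
      automatically.\<close>
    define h' where "h' c k = h c k - h c m / h d m * h d k" for c k
    have "finite ?D" "card F < card ?D"
      using insert d by auto
    then obtain a where a: "\<exists>c\<in>?D. a c \<noteq> 0" "\<And>k. k \<in> F \<Longrightarrow> (\<Sum>c\<in>?D. a c * h' c k) = 0"
      using insert.IH[of ?D h'] by blast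
    define s where "s = (\<Sum>c\<in>?D. a c * (h c m / h d m))"
    define b where "b = a(d := - s)"
    have b_sum: "(\<Sum>c\<in>D. b c * h c k) = (\<Sum>c\<in>?D. a c * h' c k)" for k
    proof -
      have "(\<Sum>c\<in>D. b c * h c k) = (\<Sum>c\<in>?D. a c * h c k) - s * h d k"
        using d insert.prems(1) by (simp add: sum.remove[of D d] b_def)
      also have "\<dots> = (\<Sum>c\<in>?D. a c * h' c k)"
        by (simp add: s_def h'_def right_diff_distrib sum_subtractf sum_distrib_right mult.assoc)
      finally show ?thesis .
    qed
    have "(\<Sum>c\<in>D. b c * h c m) = 0"
      unfolding b_sum using d by (simp add: h'_def)
    moreover have "\<exists>c\<in>D. b c \<noteq> 0"
      using a(1) by (auto simp: b_def)
    ultimately show ?thesis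
      using a(2) b_sum by auto
  qed
qed

text \<open>The graph over the support determines the map and is a finite subset of a countable
  set.\<close>

lemma countable_UNIV_poly_mapping:
  "countable (UNIV :: ('a::countable \<Rightarrow>\<^sub>0 'b::{countable,zero}) set)"
proof -
  define graph :: "('a \<Rightarrow>\<^sub>0 'b) \<Rightarrow> ('a \<times> 'b) set" where
    "graph m = (\<lambda>i. (i, Poly_Mapping.lookup m i)) ` Poly_Mapping.keys m" for m
  have "inj graph"
  proof (rule injI, rule poly_mapping_eqI)
    fix m n i
    assume "graph m = graph n"
    then have "(i, v) \<in> graph m \<longleftrightarrow> (i, v) \<in> graph n" for v
      by simp
    then show "Poly_Mapping.lookup m i = Poly_Mapping.lookup n i"
      by (auto simp: graph_def image_iff in_keys_iff) metis
  qed
  moreover have "countable (range graph)"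
    by (rule countable_subset[OF _ countable_Collect_finite]) (auto simp: graph_def)
  ultimately show ?thesis
    by (rule countable_image_inj_on[rotated])
qed

lemma uncountable_fibre:
  assumes "uncountable A" "countable (f ` A)"
  obtains y where "uncountable {x\<in>A. f x = y}"
proof (rule ccontr)
  assume "\<not> thesis"
  then have "countable (\<Union>y\<in>f ` A. {x\<in>A. f x = y})"
    using that by (intro countable_UN assms(2)) blast
  also have "(\<Union>y\<in>f ` A. {x\<in>A. f x = y}) = A"
    by auto
  finally show False
    using assms(1) by blast
qed

text \<open>There are only countably many pairs of a number and a finite support, so uncountably
  many indices share both. Their \<open>h c\<close> lie in one finite-dimensional space. The common
  \<open>N\<close> later allows a single power of \<open>f\<close> to be factored out.\<close>

lemma uncountable_family_dependent:
  fixes h :: "'i \<Rightarrow> ('k::zero \<Rightarrow>\<^sub>0 'a::field)" and n :: "'i \<Rightarrow> nat"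
  assumes "countable (UNIV :: 'k set)" "uncountable A"
  obtains D a N where "finite D" "D \<subseteq> A" "\<And>c. c \<in> D \<Longrightarrow> n c = N" "\<exists>c\<in>D. a c \<noteq> 0"
    "\<And>m. (\<Sum>c\<in>D. a c * Poly_Mapping.lookup (h c) m) = 0"
proof -
  define \<phi> where "\<phi> c = (n c, Poly_Mapping.keys (h c))" for c
  have "countable {F :: 'k set. finite F}"
    using countable_Collect_finite_subset[OF assms(1)] by simp
  then have "countable (\<phi> ` A)"
    by (intro countable_subset[of "\<phi> ` A" "UNIV \<times> {F. finite F}"]) (auto simp: \<phi>_def)
  then obtain y where "uncountable {c\<in>A. \<phi> c = y}"
    using assms(2) uncountable_fibre by blast
  moreover obtain N F where y: "y = (N, F)"
    by fastforce
  ultimately have unc: "uncountable {c\<in>A. \<phi> c = (N, F)}"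
    by simp
  then have inf: "infinite {c\<in>A. \<phi> c = (N, F)}"
    using countable_finite by blast
  \<comment> \<open>One vector more than there are coordinates.\<close>
  then obtain D where D: "finite D" "card D = Suc (card F)" "D \<subseteq> {c\<in>A. \<phi> c = (N, F)}"
    using infinite_arbitrarily_large by blast
  then have D': "n c = N" "Poly_Mapping.keys (h c) = F" if "c \<in> D" for c
    using that by (auto simp: \<phi>_def)
  have "D \<noteq> {}"
    using D by auto
  then have "finite F"
    using D' by (metis ex_in_conv finite_keys)
  then obtain a where a: "\<exists>c\<in>D. a c \<noteq> 0"
    "\<forall>m\<in>F. (\<Sum>c\<in>D. a c * Poly_Mapping.lookup (h c) m) = 0"
    using homogeneous_system_nontrivial[of F D "\<lambda>c. Poly_Mapping.lookup (h c)"] D by auto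
  have "(\<Sum>c\<in>D. a c * Poly_Mapping.lookup (h c) m) = 0" for m
  proof (cases "m \<in> F")
    case False
    then have "Poly_Mapping.lookup (h c) m = 0" if "c \<in> D" for c
      using D'(2)[OF that] by (auto simp: in_keys_iff)
    then show ?thesis by simp
  qed (use a in auto)
  then show thesis
    using that[of D N a] D D' a(1) by blast
qed

section \<open>Substitution into one-variable polynomials\<close>

abbreviation const :: "'b::zero \<Rightarrow> ('a::zero \<Rightarrow>\<^sub>0 'b)" where
  "const \<equiv> Poly_Mapping.single 0"

lemma const_mult: "const (a * b) = const a * const b"
  by (simp add: mult_single)

text \<open>Updating at a key outside the support is the same as adding a single term. The additive
  form suits the homomorphism arguments, for polynomials and for monomials alike.\<close>

lemma poly_mapping_single_add_induct [case_names zero add]: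
  assumes "P 0" "\<And>f m c. P f \<Longrightarrow> P (Poly_Mapping.single m c + f)"
  shows "P (f :: 'a \<Rightarrow>\<^sub>0 'b::monoid_add)"
proof (induction f rule: update_induct)
  case const
  show ?case by (rule assms(1))
next
  case (update f m c)
  have "Poly_Mapping.update m c f = Poly_Mapping.single m c + f"
    using update(1) by (intro poly_mapping_eqI)
      (auto simp: lookup_update lookup_add lookup_single in_keys_iff when_def)
  then show ?case
    using assms(2) update by simp
qed

lemma lookup_const_mult:
  fixes f :: "'a::monoid_add \<Rightarrow>\<^sub>0 'b::semiring_0"
  shows "Poly_Mapping.lookup (const c * f) m = c * Poly_Mapping.lookup f m"
  by (induction f rule: poly_mapping_single_add_induct)
     (auto simp: distrib_left lookup_add mult_single lookup_single when_def)

text \<open>The evaluation homomorphism sending the variable to \<open>g\<close>. As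
  \<open>poly\<close> wants coefficients and argument in one ring, the coefficients are first
  embedded by \<open>const\<close>.\<close>

definition subst_poly :: "('k::comm_monoid_add \<Rightarrow>\<^sub>0 'a::comm_ring_1) \<Rightarrow> 'a poly \<Rightarrow> ('k \<Rightarrow>\<^sub>0 'a)" where
  "subst_poly g p = poly (map_poly const p) g"

lemma subst_poly_0 [simp]: "subst_poly g 0 = 0"
  by (simp add: subst_poly_def)

lemma subst_poly_pCons [simp]: "subst_poly g (pCons a p) = const a + g * subst_poly g p"
  by (simp add: subst_poly_def map_poly_pCons)

lemma subst_poly_1 [simp]: "subst_poly g 1 = 1"
  by (simp add: one_pCons)

lemma subst_poly_smult: "subst_poly g (smult a p) = const a * subst_poly g p"
  by (induction p) (auto simp: const_mult algebra_simps)

lemma subst_poly_add: "subst_poly g (p + q) = subst_poly g p + subst_poly g q"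
  by (induction p q rule: poly_induct2) (auto simp: single_add algebra_simps)

lemma subst_poly_mult: "subst_poly g (p * q) = subst_poly g p * subst_poly g q"
  by (induction p) (auto simp: subst_poly_smult subst_poly_add algebra_simps)

lemma subst_poly_sum: "subst_poly g (sum p A) = (\<Sum>x\<in>A. subst_poly g (p x))"
  by (induction A rule: infinite_finite_induct) (auto simp: subst_poly_add)

lemma subst_poly_prod: "subst_poly g (prod p A) = (\<Prod>x\<in>A. subst_poly g (p x))"
  by (induction A rule: infinite_finite_induct) (auto simp: subst_poly_mult)

lemma subst_poly_linear: "subst_poly g [:- c, 1:] = g - const c"
  by (simp add: single_uminus)

section \<open>Residues modulo a maximal avoiding ideal are constant\<close>

text \<open>Over \<complex> a root of \<open>q\<close> can be split off; by primality either its
  linear factor or the cofactor of smaller degree lands in \<open>P\<close>. A nonzero constant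
  cannot, since it is a unit.\<close>

lemma prime_ideal_subst_poly:
  fixes P :: "('k::comm_monoid_add \<Rightarrow>\<^sub>0 complex) set"
  assumes "is_ideal P" "1 \<notin> P" and prime: "\<And>x y. x * y \<in> P \<Longrightarrow> x \<in> P \<or> y \<in> P"
    and "q \<noteq> 0" "subst_poly g q \<in> P"
  shows "\<exists>r. g - const r \<in> P"
  using assms(4,5)
proof (induction "degree q" arbitrary: q)
  case 0
  then obtain k where q: "q = [:k:]" "k \<noteq> 0"
    by (metis degree_eq_zeroE pCons_0_0)
  then have "const (1 / k) * const k \<in> P"
    using 0 by (intro is_ideal_mult_left[OF assms(1)]) simp
  then show ?case
    using q assms(2) by (simp flip: const_mult)
next
  case (Suc d)
  then obtain r where "poly q r = 0"
    using fundamental_theorem_of_algebra[of q] by (auto simp: constant_degree)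
  then obtain q' where q: "q = [:- r, 1:] * q'"
    by (metis poly_eq_0_iff_dvd dvdE)
  with Suc.prems have "q' \<noteq> 0"
    by auto
  then have "degree q' = d"
    using Suc.hyps(2) unfolding q by (subst (asm) degree_mult_eq) auto
  have "(g - const r) * subst_poly g q' \<in> P"
    using Suc.prems(2) unfolding q subst_poly_mult subst_poly_linear .
  then show ?case
    using prime Suc.hyps(1) \<open>degree q' = d\<close> \<open>q' \<noteq> 0\<close> by blast
qed

text \<open>Modulo \<open>P\<close>, \<open>h c\<close> plays the role of
  \<open>f ^ n c / (g - c)\<close>; uncountably many such fractions cannot be independent in a space
  of countable dimension.\<close>

lemma max_avoiding_residue_const:
  fixes P :: "('k::comm_monoid_add \<Rightarrow>\<^sub>0 complex) set"
  assumes P: "max_avoiding f P" and "countable (UNIV :: 'k set)"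
  shows "\<exists>r. g - const r \<in> P"
proof (rule ccontr)
  assume contra: "\<nexists>r. g - const r \<in> P"
  then have "\<exists>n b. f ^ n - b * (g - const c) \<in> P" for c
    using max_avoiding_absorb[OF P] by metis
  then obtain n h where nh: "\<And>c. f ^ n c - h c * (g - const c) \<in> P"
    by metis
  obtain D a N where D: "finite D" "\<And>c. c \<in> D \<Longrightarrow> n c = N" "\<exists>c\<in>D. a c \<noteq> 0"
    and dep: "\<And>m. (\<Sum>c\<in>D. a c * Poly_Mapping.lookup (h c) m) = 0"
    using uncountable_family_dependent[OF assms(2) uncountable_UNIV_complex, of n h] by metis
  have ah: "(\<Sum>c\<in>D. const (a c) * h c) = 0"
    by (rule poly_mapping_eqI) (simp add: lookup_sum lookup_const_mult dep)
  \<comment> \<open>The numerator of the sum of \<open>a c / (X - c)\<close> over the common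
    denominator.\<close>
  define q where "q = (\<Sum>c\<in>D. smult (a c) (\<Prod>d\<in>D - {c}. [:- d, 1:]))"
  define L where "L c = (\<Prod>d\<in>D - {c}. g - const d)" for c
  have "q \<noteq> 0"
  proof -
    obtain e where e: "e \<in> D" "a e \<noteq> 0"
      using D(3) by blast
    \<comment> \<open>At \<open>e\<close> every summand with \<open>c \<noteq> e\<close> has the
      factor \<open>e - e\<close>, so only a nonzero term survives.\<close>
    have "poly q e = (\<Sum>c\<in>D. a c * (\<Prod>d\<in>D - {c}. e - d))"
      by (simp add: q_def poly_sum poly_prod)
    also have "\<dots> = (\<Sum>c\<in>D. if c = e then a e * (\<Prod>d\<in>D - {e}. e - d) else 0)"
      using D(1) e by (intro sum.cong) auto
    also have "\<dots> = a e * (\<Prod>d\<in>D - {e}. e - d)"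
      using D(1) e by simp
    also have "\<dots> \<noteq> 0"
      using D(1) e by auto
    finally show ?thesis by auto
  qed
  \<comment> \<open>The weight \<open>L c\<close> completes \<open>g - const c\<close> to the full
    product, which then factors out of the terms in \<open>h c\<close> and leaves the vanishing
    combination \<open>ah\<close>.\<close>
  have "(\<Sum>c\<in>D. const (a c) * L c * (f ^ N - h c * (g - const c))) \<in> P"
    using nh D(2) by (intro is_ideal_sum is_ideal_mult_left max_avoiding_ideal[OF P]) metis
  also have "(\<Sum>c\<in>D. const (a c) * L c * (f ^ N - h c * (g - const c))) =
      (\<Sum>c\<in>D. f ^ N * (const (a c) * L c) - (\<Prod>d\<in>D. g - const d) * (const (a c) * h c))"
  proof (rule sum.cong)
    fix c assume "c \<in> D"
    then have L: "(\<Prod>d\<in>D. g - const d) = (g - const c) * L c"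
      using D(1) by (simp add: L_def prod.remove)
    show "const (a c) * L c * (f ^ N - h c * (g - const c)) =
        f ^ N * (const (a c) * L c) - (\<Prod>d\<in>D. g - const d) * (const (a c) * h c)"
      unfolding L by (simp add: algebra_simps)
  qed simp
  also have "\<dots> = f ^ N * subst_poly g q"
    by (simp add: sum_subtractf ah q_def L_def subst_poly_sum subst_poly_smult subst_poly_prod
        subst_poly_linear del: subst_poly_pCons flip: sum_distrib_left)
  finally have "subst_poly g q \<in> P"
    using max_avoiding_prime[OF P] max_avoiding_power[OF P] by blast
  then show False
    using prime_ideal_subst_poly[OF max_avoiding_ideal[OF P] max_avoiding_one[OF P]
        max_avoiding_prime[OF P] \<open>q \<noteq> 0\<close>] contra by blast
qed

section \<open>Evaluation\<close>

text \<open>Additivity needs a common index set, because the support of a sum may be smaller than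
  the union of the supports.\<close>

lemma eval_monomial_superset:
  assumes "finite A" "Poly_Mapping.keys m \<subseteq> A"
  shows "eval_monomial a m = (\<Prod>i\<in>A. a i ^ Poly_Mapping.lookup m i)"
  unfolding eval_monomial_def using assms
  by (intro prod.mono_neutral_left) (auto simp: in_keys_iff)

lemma eval_poly_superset:
  assumes "finite A" "Poly_Mapping.keys f \<subseteq> A"
  shows "eval_poly a f = (\<Sum>m\<in>A. Poly_Mapping.lookup f m * eval_monomial a m)"
  unfolding eval_poly_def using assms
  by (intro sum.mono_neutral_left) (auto simp: in_keys_iff)

lemma eval_monomial_0 [simp]: "eval_monomial a 0 = 1"
  by (simp add: eval_monomial_def)

lemma eval_monomial_add: "eval_monomial a (m + n) = eval_monomial a m * eval_monomial a n"
proof -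
  let ?A = "Poly_Mapping.keys m \<union> Poly_Mapping.keys n"
  have "finite ?A" by simp
  then show ?thesis
    using keys_add[of m n]
    by (simp add: eval_monomial_superset[of ?A] lookup_add power_add prod.distrib)
qed

lemma eval_monomial_single: "eval_monomial a (Poly_Mapping.single i k) = a i ^ k"
  by (cases "k = 0") (auto simp: eval_monomial_def)

lemma eval_poly_0 [simp]: "eval_poly a 0 = 0"
  by (simp add: eval_poly_def)

lemma eval_poly_single: "eval_poly a (Poly_Mapping.single m c) = c * eval_monomial a m"
  by (cases "c = 0") (auto simp: eval_poly_def)

lemma eval_poly_1 [simp]: "eval_poly a 1 = 1"
  using eval_poly_single[of a 0 1] by simp

lemma eval_poly_add: "eval_poly a (f + g) = eval_poly a f + eval_poly a g"
proof -
  let ?A = "Poly_Mapping.keys f \<union> Poly_Mapping.keys g"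
  have "finite ?A" by simp
  then show ?thesis
    using keys_add[of f g]
    by (simp add: eval_poly_superset[of ?A] lookup_add distrib_right sum.distrib)
qed

lemma eval_poly_mult: "eval_poly a (f * g) = eval_poly a f * eval_poly a g"
proof (induction f rule: poly_mapping_single_add_induct)
  case (add f m c)
  have "eval_poly a (Poly_Mapping.single m c * g) =
      eval_poly a (Poly_Mapping.single m c) * eval_poly a g"
    by (induction g rule: poly_mapping_single_add_induct)
       (auto simp: distrib_left eval_poly_add mult_single eval_poly_single eval_monomial_add)
  then show ?case
    by (simp add: add distrib_right eval_poly_add)
qed simp

lemma eval_poly_power: "eval_poly a (f ^ n) = eval_poly a f ^ n"
  by (induction n) (auto simp: eval_poly_mult)

text \<open>The polynomials congruent to their value at \<open>a\<close> form a subring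
  \<open>R\<close> containing the constants and the variables, hence everything.\<close>

lemma poly_eval_congruence:
  fixes f :: inf_poly
  assumes P: "is_ideal P"
    and var: "\<And>i. Poly_Mapping.single (Poly_Mapping.single i 1) 1 - const (a i) \<in> P"
  shows "f - const (eval_poly a f) \<in> P"
proof -
  define R where "R = {f. f - const (eval_poly a f) \<in> P}"
  have R_add: "f + g \<in> R" if "f \<in> R" "g \<in> R" for f g
    using is_ideal_add[OF P, of "f - const (eval_poly a f)" "g - const (eval_poly a g)"] that
    by (simp add: R_def eval_poly_add single_add algebra_simps)
  have mult: "f * g \<in> R" if "f \<in> R" "g \<in> R" for f g
  proof -
    \<comment> \<open>This combination equals
      \<open>f * g - const (eval_poly a f) * const (eval_poly a g)\<close>.\<close>
    have "g * (f - const (eval_poly a f)) + const (eval_poly a f) * (g - const (eval_poly a g)) \<in> P"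
      using that by (intro is_ideal_add is_ideal_mult_left P) (auto simp: R_def)
    then show ?thesis
      by (simp add: R_def eval_poly_mult const_mult algebra_simps)
  qed
  have const: "const c \<in> R" for c
    using is_ideal_zero[OF P] by (simp add: R_def eval_poly_single)
  have one: "1 \<in> R"
    using const[of 1] by simp
  have "Poly_Mapping.single (Poly_Mapping.single i k) 1 \<in> R" for i k
  proof (induction k)
    case (Suc k)
    have "Poly_Mapping.single (Poly_Mapping.single i 1) 1 \<in> R"
      using var by (simp add: R_def eval_poly_single eval_monomial_single)
    from mult[OF this Suc] show ?case
      by (simp add: mult_single flip: single_add)
  qed (use one in simp)
  then have monom: "Poly_Mapping.single m 1 \<in> R" for m
  proof (induction m rule: poly_mapping_single_add_induct)
    case (add m i k)
    then show ?case
      using mult[of "Poly_Mapping.single (Poly_Mapping.single i k) 1" "Poly_Mapping.single m 1"]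
      by (simp add: mult_single)
  qed (use one in simp)
  have "f \<in> R"
  proof (induction f rule: poly_mapping_single_add_induct)
    case zero
    show ?case using const[of 0] by simp
  next
    case (add f m c)
    then show ?case
      using R_add[OF mult[OF const[of c] monom[of m]]]
      by (simp add: mult_single)
  qed
  then show ?thesis
    by (simp add: R_def)
qed

section \<open>The point given by the residues of the variables, and the Nullstellensatz\<close>

lemma zero_locus_point_exists:
  fixes J :: "inf_poly set"
  assumes "is_ideal J" "\<And>n. f ^ n \<notin> J"
  obtains a where "a \<in> zero_locus J" "eval_poly a f \<noteq> 0"
proof -
  obtain P where "J \<subseteq> P" and max: "max_avoiding f P"
    using max_avoiding_exists[OF assms] .
  note P = max_avoiding_ideal[OF max]
  have "\<exists>r. Poly_Mapping.single (Poly_Mapping.single i 1) 1 - const r \<in> P" for i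
    by (rule max_avoiding_residue_const[OF max countable_UNIV_poly_mapping])
  then obtain a where "\<And>i. Poly_Mapping.single (Poly_Mapping.single i 1) 1 - const (a i) \<in> P"
    by metis
  then have cong: "g - const (eval_poly a g) \<in> P" for g
    by (rule poly_eval_congruence[OF P])
  have zero: "eval_poly a g = 0" if "g \<in> P" for g
  proof (rule ccontr)
    assume "eval_poly a g \<noteq> 0"
    moreover have "const (eval_poly a g) \<in> P"
      using is_ideal_diff[OF P that cong[of g]] by simp
    then have "const (1 / eval_poly a g) * const (eval_poly a g) \<in> P"
      by (rule is_ideal_mult_left[OF P])
    ultimately show False
      using max_avoiding_one[OF max] by (simp flip: const_mult)
  qed
  have "a \<in> zero_locus J"
    using zero \<open>J \<subseteq> P\<close> by (auto simp: zero_locus_def)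
  \<comment> \<open>If \<open>f\<close> vanished at \<open>a\<close>, the congruence would put
    \<open>f ^ 1\<close> into \<open>P\<close>.\<close>
  moreover have "eval_poly a f \<noteq> 0"
    using cong[of f] max_avoiding_power[OF max, of 1] by auto
  ultimately show thesis ..
qed

theorem theorem6p6:
  fixes J :: "inf_poly set"
  assumes "is_ideal J"
  shows "vanishing_ideal (zero_locus J) = radical J"
proof
  show "radical J \<subseteq> vanishing_ideal (zero_locus J)"
    by (auto simp: radical_def vanishing_ideal_def zero_locus_def)
      (metis eval_poly_power power_eq_0_iff)
next
  show "vanishing_ideal (zero_locus J) \<subseteq> radical J"
  proof
    fix f assume f: "f \<in> vanishing_ideal (zero_locus J)"
    then obtain n where "f ^ n \<in> J"
      using zero_locus_point_exists[OF assms, of f] by (auto simp: vanishing_ideal_def)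
    \<comment> \<open>The exponent found may be \<open>0\<close>, whereas \<open>radical\<close>
      asks for a positive one.\<close>
    then have "f ^ Suc n \<in> J"
      using is_ideal_mult_left[OF assms] by simp
    then show "f \<in> radical J"
      unfolding radical_def by (intro CollectI exI[of _ "Suc n"]) simp
  qed
qed

end
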